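(* Let $p\ge q\ge 1$ be integers and let $\mathcal F\subseteq\binom{[p]}{q}$ be $q/p$-regular. Then $\mathrm{NRD}(\mathrm{OR\text{-}DP}_{\mathcal F},n)=\Theta(n^{p/q})$, with implied constants depending only on $p$ and $q$.
   Context: Let $E_{p,q}=\{0,1\}^q$. For $x\in\{0,1\}^p$ and $S\in\binom{[p]}{q}$, $x|_S\in\{0,1\}^q$ denotes the restriction of $x$ to the coordinates in $S$ (listed in increasing order). Define $\mathrm{proj}_{\mathcal F}(x)=(x|_S : S\in\mathcal F)\in E_{p,q}^{\mathcal F}$ and $\mathrm{OR\text{-}DP}_{\mathcal F}=\{\mathrm{proj}_{\mathcal F}(x): x\in\{0,1\}^p\setminus\{0^p\}\}$, a relation of arity $|\mathcal F|$ over $E_{p,q}$. $\mathcal F$ is $q/p$-regular if there is a probability distribution on $\mathcal F$ such that for every $i\in[p]$ a random $S$ contains $i$ with probability exactly $q/p$. For a finite set $D$ and relation $R\subseteq D^r$, an instance of $\mathrm{CSP}(R)$ is $(X,Y)$ with $X$ finite, $Y\subseteq X^r$; it is non-redundant if for each $y\in Y$ some $\sigma:X\to D$ maps every clause of $Y\setminus\{y\}$ into $R$ but not $y$; $\mathrm{NRD}(R,n)$ is the maximum $|Y|$ over non-redundant instances with $|X|=n$. *)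

theory Defs
  imports "HOL-Probability.Probability" "HOL-Library.FuncSet" "HOL-Library.Ramsey"
begin

text \<open>
  Tuples of arity \<open>r\<close> are extensional functions on an index set \<open>I\<close> with \<open>r\<close> elements,
  so \<open>D\<^sup>r\<close> is \<open>I \<rightarrow>\<^sub>E D\<close>.  A family \<open>F\<close> can then itself be the index set, and no
  enumeration of \<open>F\<close> has to be chosen.  \<open>compose I \<sigma> y\<close> applies \<open>\<sigma>\<close> to the tuple \<open>y\<close>
  coordinatewise.
\<close>

definition non_redundant ::
  "'d set \<Rightarrow> 'i set \<Rightarrow> ('i \<Rightarrow> 'd) set \<Rightarrow> 'v set \<Rightarrow> ('i \<Rightarrow> 'v) set \<Rightarrow> bool" where
  "non_redundant D I R X Y \<longleftrightarrow>
     finite X \<and> Y \<subseteq> (I \<rightarrow>\<^sub>E X) \<and>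
     (\<forall>y\<in>Y. \<exists>\<sigma> \<in> X \<rightarrow> D. (\<forall>z\<in>Y - {y}. compose I \<sigma> z \<in> R) \<and> compose I \<sigma> y \<notin> R)"

text \<open>
  Non-redundancy is invariant under renaming variables, so it suffices to let \<open>X\<close> range
  over finite sets of natural numbers.
\<close>

definition NRD :: "'d set \<Rightarrow> 'i set \<Rightarrow> ('i \<Rightarrow> 'd) set \<Rightarrow> nat \<Rightarrow> nat" where
  "NRD D I R n =
     Max {card Y |(X :: nat set) Y. card X = n \<and> non_redundant D I R X Y}"

lemma NRD_Max_well_defined:
  assumes "finite I"
  shows "finite {card Y |(X :: nat set) Y. card X = n \<and> non_redundant D I R X Y}" (is "finite ?A")
    and "{card Y |(X :: nat set) Y. card X = n \<and> non_redundant D I R X Y} \<noteq> {}"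
proof -
  have "card Y \<le> n ^ card I"
    if "card X = n" "non_redundant D I R X Y" for X :: "nat set" and Y
  proof -
    have "finite (I \<rightarrow>\<^sub>E X)" "Y \<subseteq> (I \<rightarrow>\<^sub>E X)"
      using that assms by (auto simp: non_redundant_def intro: finite_PiE)
    then have "card Y \<le> card (I \<rightarrow>\<^sub>E X)"
      by (rule card_mono)
    with that assms show ?thesis
      by (simp add: card_PiE)
  qed
  then have "?A \<subseteq> {..n ^ card I}"
    by auto
  then show "finite ?A"
    by (rule finite_subset) simp
  have "card {..<n} = n \<and> non_redundant D I R {..<n} {}"
    by (simp add: non_redundant_def)
  then show "?A \<noteq> {}"
    by blast
qed

definition cube :: "nat \<Rightarrow> bool list set" where
  "cube k = {x. length x = k}"

text \<open>
  Coordinates are numbered from \<open>0\<close>, so \<open>[p]\<close> is \<open>{..<p}\<close>.  \<open>nths x S\<close> lists the entries of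
  \<open>x\<close> at positions in \<open>S\<close> in increasing order.
\<close>

definition proj :: "nat set set \<Rightarrow> bool list \<Rightarrow> (nat set \<Rightarrow> bool list)" where
  "proj F x = (\<lambda>S\<in>F. nths x S)"

definition OR_DP :: "nat \<Rightarrow> nat set set \<Rightarrow> (nat set \<Rightarrow> bool list) set" where
  "OR_DP p F = proj F ` (cube p - {replicate p False})"

definition regular_family :: "nat \<Rightarrow> nat \<Rightarrow> nat set set \<Rightarrow> bool" where
  "regular_family p q F \<longleftrightarrow>
     (\<exists>\<mu> :: nat set pmf. set_pmf \<mu> \<subseteq> F \<and>
        (\<forall>i<p. measure_pmf.prob \<mu> {S. i \<in> S} = real q / real p))"

lemma OR_DP_subset:
  assumes "F \<subseteq> nsets {..<p} q"
  shows "OR_DP p F \<subseteq> (F \<rightarrow>\<^sub>E cube q)"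
proof -
  have "length (nths x S) = q" if "S \<in> F" "length x = p" for x :: "bool list" and S
  proof -
    have "{i. i < p \<and> i \<in> S} = S" "card S = q"
      using assms that by (auto simp: nsets_def)
    with that show ?thesis
      by (simp add: length_nths)
  qed
  then show ?thesis
    by (auto simp: OR_DP_def proj_def cube_def)
qed

end

theory Submission
  imports Defs
begin

text \<open>
  For the upper bound, split \<open>Y\<close> according to whether the assignment \<open>\<sigma>\<^sub>y\<close> separating \<open>y\<close> maps it
  outside the linear relation \<open>proj F ` {0,1}\<^sup>p\<close> or to the zero tuple.  The first part has at most
  \<open>q n\<close> elements, since each of its clauses at least halves the \<open>\<bbbF>\<^sub>2\<close>-space of satisfying
  assignments.  For \<open>w, y\<close> in the second part, \<open>\<sigma>\<^sub>w\<close> maps \<open>y\<close> to \<open>proj F x\<^sub>w\<^sub>y\<close> with \<open>x\<^sub>w\<^sub>y = 0\<close> iff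
  \<open>w = y\<close>.  Hence \<open>y\<close> is determined by the \<open>p\<close>-tuple of sets \<open>A\<^sub>i(y) = {w. x\<^sub>w\<^sub>y ! i}\<close>, whose
  restriction to \<open>S\<close> depends only on the variable \<open>y S\<close> and so takes at most \<open>n\<close> values;
  Shearer's inequality gives the bound \<open>n\<^bsup>p/q\<^esup>\<close>.

  For the lower bound, take as variables the pairs \<open>(S, b)\<close> with \<open>b \<in> [m]\<^sup>q\<close>, and one clause
  \<open>S \<mapsto> (S, a|S)\<close> for each \<open>a \<in> [m]\<^sup>p\<close>.  The assignment for \<open>a\<close> records in which coordinates
  \<open>b\<close> differs from \<open>a|S\<close>.
\<close>

section \<open>Shearer's inequality, by counting\<close>

text \<open>
  \<open>N (Suc i) a / N i a\<close> is the probability that a uniform element of \<open>T\<close> has \<open>i\<close>-th entry \<open>a i\<close>, given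
  its earlier entries.  The sum is the probability that \<open>T\<close> is not left before step \<open>k\<close> when the
  entries are drawn one by one from these laws, except that those in \<open>S\<close> are forced to be \<open>b\<close>.
\<close>

lemma sum_inverse_card_agree_le:
  fixes T :: "(nat \<Rightarrow> 'b) set" and S :: "nat set" and b :: "nat \<Rightarrow> 'b"
  assumes T: "finite T" "T \<noteq> {}"
  defines "N \<equiv> \<lambda>k a. real (card {c \<in> T. \<forall>j<k. c j = a j})"
  shows "(\<Sum>a | a \<in> T \<and> (\<forall>j\<in>S. j < k \<longrightarrow> a j = b j).
           (\<Prod>i\<in>{..<k} - S. N (Suc i) a / N i a) / N k a) \<le> 1"
proof (induction k)
  case 0
  have "N 0 = (\<lambda>a. real (card T))"
    by (simp add: N_def)
  then show ?case
    using T by simp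
next
  case (Suc k)
  define A where "A k = {a \<in> T. \<forall>j\<in>S. j < k \<longrightarrow> a j = b j}" for k
  define W where "W k a = (\<Prod>i\<in>{..<k} - S. N (Suc i) a / N i a)" for k a
  have finA: "finite (A k)" for k
    using T by (simp add: A_def)
  have Npos: "N k a > 0" if "a \<in> T" for k a
    using that T by (auto simp: N_def card_gt_0_iff)
  have IH: "(\<Sum>a\<in>A k. W k a / N k a) \<le> 1"
    using Suc.IH by (simp add: A_def W_def)
  \<comment> \<open>For \<open>k\<close> outside \<open>S\<close> the new factor of \<open>W\<close>
    cancels the change in \<open>N\<close>. For \<open>k\<close> in \<open>S\<close> the forced
    entry may leave \<open>T\<close>, so mass can only be lost.\<close>
  have "(\<Sum>a\<in>A (Suc k). W (Suc k) a / N (Suc k) a) \<le> (\<Sum>a\<in>A k. W k a / N k a)"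
  proof (cases "k \<in> S")
    case False
    have "A (Suc k) = A k"
      using False by (auto simp: A_def less_Suc_eq)
    moreover have "W (Suc k) a / N (Suc k) a = W k a / N k a" if "a \<in> A k" for a
    proof -
      have "{..<Suc k} - S = insert k ({..<k} - S)"
        using False by auto
      then have "W (Suc k) a = N (Suc k) a / N k a * W k a"
        by (simp add: W_def)
      moreover have "N (Suc k) a > 0"
        using that Npos by (simp add: A_def)
      ultimately show ?thesis
        by simp
    qed
    ultimately show ?thesis
      by simp
  next
    case True
    define E where "E a = {c \<in> T. \<forall>j<k. c j = a j}" for a
    have WSuc: "W (Suc k) = W k"
      by (simp only: W_def[abs_def] lessThan_Suc insert_Diff_if True if_True)
    have finE: "finite (E a)" for a
      using T by (simp add: E_def)
    have NE: "N k a = card (E a)" for a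
      by (simp add: N_def E_def)
    have N_cong: "N i c = N i a" if "c \<in> E a" "i \<le> k" for i a c
    proof -
      have "{d \<in> T. \<forall>j<i. d j = c j} = {d \<in> T. \<forall>j<i. d j = a j}"
        using that by (auto simp: E_def)
      then show ?thesis
        by (simp add: N_def)
    qed
    have W_cong: "W k c = W k a" if "c \<in> E a" for a c
      unfolding W_def by (intro prod.cong) (use that in \<open>auto simp: N_cong\<close>)
    have W_nonneg: "W k a \<ge> 0" for a
      by (auto simp: W_def N_def intro!: prod_nonneg)
    have EA: "E a \<subseteq> A k" if "a \<in> A (Suc k)" for a
      using that by (auto simp: E_def A_def)
    \<comment> \<open>The term of \<open>a\<close> is split into \<open>N k a\<close> equal shares
      over its class \<open>E a\<close>, on which \<open>W k\<close> and \<open>N k\<close> are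
      constant; exchanging the sums collects the shares by \<open>c\<close>.\<close>
    have "(\<Sum>a\<in>A (Suc k). W k a / N (Suc k) a)
        = (\<Sum>a\<in>A (Suc k). \<Sum>c\<in>E a. W k c / N k c * (1 / N (Suc k) a))"
    proof (intro sum.cong refl)
      fix a assume a: "a \<in> A (Suc k)"
      then have "N k a > 0"
        using Npos by (simp add: A_def)
      moreover have "(\<Sum>c\<in>E a. W k c / N k c * (1 / N (Suc k) a))
          = (\<Sum>c\<in>E a. W k a / N k a * (1 / N (Suc k) a))"
        by (intro sum.cong refl) (simp add: N_cong[where a = a] W_cong[where a = a])
      ultimately show "W k a / N (Suc k) a = (\<Sum>c\<in>E a. W k c / N k c * (1 / N (Suc k) a))"
        by (simp add: NE)
    qed
    also have "\<dots> = (\<Sum>a\<in>A (Suc k). \<Sum>c | c \<in> A k \<and> c \<in> E a. W k c / N k c * (1 / N (Suc k) a))"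
      by (intro sum.cong refl) (use EA in auto)
    also have "\<dots> = (\<Sum>c\<in>A k. \<Sum>a | a \<in> A (Suc k) \<and> c \<in> E a. W k c / N k c * (1 / N (Suc k) a))"
      by (rule sum.swap_restrict) (use finA in auto)
    also have "\<dots> \<le> (\<Sum>c\<in>A k. W k c / N k c)"
    proof (intro sum_mono)
      fix c assume c: "c \<in> A k"
      let ?B = "{a \<in> A (Suc k). c \<in> E a}"
      \<comment> \<open>Members of \<open>?B\<close> share the first \<open>k\<close> entries of
        \<open>c\<close> and the forced entry \<open>b k\<close>, so \<open>?B\<close> is itself the
        class counted by \<open>N (Suc k)\<close>. The reciprocals sum to 1, or to 0 if
        \<open>?B\<close> is empty.\<close>
      have B: "N (Suc k) a = card ?B" if "a \<in> ?B" for a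
      proof -
        have "{d \<in> T. \<forall>j<Suc k. d j = a j} = ?B"
          using that c True by (auto simp: A_def E_def less_Suc_eq)
        then show ?thesis
          by (simp add: N_def)
      qed
      have "(\<Sum>a\<in>?B. 1 / N (Suc k) a) = (\<Sum>a\<in>?B. 1 / real (card ?B))"
        by (intro sum.cong refl) (use B in simp)
      also have "\<dots> \<le> 1"
        by simp
      finally have "(\<Sum>a\<in>?B. 1 / N (Suc k) a) \<le> 1" .
      moreover have "W k c / N k c \<ge> 0"
        using W_nonneg by (simp add: N_def)
      ultimately show "(\<Sum>a\<in>?B. W k c / N k c * (1 / N (Suc k) a)) \<le> W k c / N k c"
        unfolding sum_distrib_left[symmetric] by (intro mult_left_le)
    qed
    finally show ?thesis
      by (simp add: WSuc)
  qed
  with IH show ?case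
    by (simp add: A_def W_def)
qed

text \<open>At every \<open>a\<close> in \<open>T\<close>, Jensen's inequality for
  \<open>exp\<close> bounds \<open>card T powr t\<close> by the \<open>w\<close>-average of the
  products of \<open>1 / d i a\<close> over \<open>i\<close> in \<open>S\<close>. Summing over
  \<open>T\<close> and applying the preceding lemma brings in the projection sizes. This is the
  arithmetic-mean form of the usual geometric-mean bound.\<close>

lemma shearer_inequality:
  fixes T :: "(nat \<Rightarrow> 'b) set" and F :: "nat set set" and w :: "nat set \<Rightarrow> real"
  assumes T: "T \<subseteq> extensional {..<p}" "finite T" "T \<noteq> {}"
    and F: "finite F" "F \<subseteq> Pow {..<p}"
    and w: "\<And>S. S \<in> F \<Longrightarrow> w S \<ge> 0" "sum w F = 1"
    and cover: "\<And>i. i < p \<Longrightarrow> (\<Sum>S | S \<in> F \<and> i \<in> S. w S) = t"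
  shows "real (card T) powr t \<le> (\<Sum>S\<in>F. w S * real (card ((\<lambda>a. restrict a S) ` T)))"
proof -
  define N where "N k a = real (card {c \<in> T. \<forall>j<k. c j = a j})" for k and a :: "nat \<Rightarrow> 'b"
  \<comment> \<open>The conditional probability of the entry \<open>a i\<close> given the earlier
    ones; the product over all \<open>i < p\<close> telescopes to \<open>1 / card T\<close>.\<close>
  define d where "d i a = N (Suc i) a / N i a" for i a
  have cardT: "real (card T) > 0"
    using T by (simp add: card_gt_0_iff)
  have Npos: "N k a > 0" if "a \<in> T" for k a
    using that T by (auto simp: N_def card_gt_0_iff)
  have dpos: "d i a > 0" if "a \<in> T" for i a
    using Npos that by (simp add: d_def)
  have Np: "N p a = 1" if "a \<in> T" for a
  proof -
    have "{c \<in> T. \<forall>j<p. c j = a j} = {a}"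
      using that T by (auto intro: extensionalityI)
    then show ?thesis
      by (simp add: N_def)
  qed
  have prod_d: "(\<Prod>i<p. d i a) = 1 / card T" if "a \<in> T" for a
  proof -
    have "(\<Prod>i<k. d i a) = N k a / N 0 a" for k
    proof (induction k)
      case 0
      then show ?case
        using Npos[OF that, of 0] by simp
    next
      case (Suc k)
      then show ?case
        using Npos[OF that, of k] by (simp add: d_def)
    qed
    then show ?thesis
      using Np that by (simp add: N_def)
  qed
  \<comment> \<open>The reciprocals over \<open>S\<close> equal \<open>card T\<close> times the
    product of \<open>d\<close> over the complement. For each pattern \<open>b\<close> on
    \<open>S\<close>, that product sums to at most 1.\<close>
  have step: "(\<Sum>a\<in>T. \<Prod>i\<in>S. 1 / d i a) \<le> card T * card ((\<lambda>a. restrict a S) ` T)"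
    if "S \<in> F" for S
  proof -
    have S: "S \<subseteq> {..<p}"
      using F that by auto
    have "(\<Sum>a\<in>T. \<Prod>i\<in>{..<p} - S. d i a)
        = (\<Sum>b\<in>(\<lambda>a. restrict a S) ` T. \<Sum>a | a \<in> T \<and> restrict a S = b. \<Prod>i\<in>{..<p} - S. d i a)"
      using T by (intro sum.image_gen)
    also have "\<dots> \<le> (\<Sum>b\<in>(\<lambda>a. restrict a S) ` T. 1)"
    proof (intro sum_mono)
      fix b assume "b \<in> (\<lambda>a. restrict a S) ` T"
      then have "{a \<in> T. restrict a S = b} = {a \<in> T. \<forall>j\<in>S. j < p \<longrightarrow> a j = b j}"
        using S by (auto simp: restrict_def fun_eq_iff)
      then have "(\<Sum>a | a \<in> T \<and> restrict a S = b. \<Prod>i\<in>{..<p} - S. d i a)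
          = (\<Sum>a | a \<in> T \<and> (\<forall>j\<in>S. j < p \<longrightarrow> a j = b j). (\<Prod>i\<in>{..<p} - S. d i a) / N p a)"
        by (intro sum.cong) (auto simp: Np)
      also have "\<dots> \<le> 1"
        using sum_inverse_card_agree_le[OF T(2,3), where S = S and k = p and b = b] by (simp add: d_def N_def)
      finally show "(\<Sum>a | a \<in> T \<and> restrict a S = b. \<Prod>i\<in>{..<p} - S. d i a) \<le> 1" .
    qed
    finally have le: "(\<Sum>a\<in>T. \<Prod>i\<in>{..<p} - S. d i a) \<le> card ((\<lambda>a. restrict a S) ` T)"
      by simp
    have "(\<Sum>a\<in>T. \<Prod>i\<in>S. 1 / d i a) = (\<Sum>a\<in>T. card T * (\<Prod>i\<in>{..<p} - S. d i a))"
    proof (intro sum.cong refl)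
      fix a assume a: "a \<in> T"
      have "(\<Prod>i\<in>{..<p} - S. d i a) * (\<Prod>i\<in>S. d i a) = 1 / card T"
        using prod_d[OF a] prod.subset_diff[OF S, of "\<lambda>i. d i a"] by simp
      moreover have "(\<Prod>i\<in>S. d i a) > 0"
        using dpos[OF a] by (intro prod_pos) auto
      ultimately show "(\<Prod>i\<in>S. 1 / d i a) = card T * (\<Prod>i\<in>{..<p} - S. d i a)"
        using cardT by (simp add: prod_dividef divide_eq_eq eq_divide_eq mult_ac)
    qed
    also have "\<dots> \<le> card T * card ((\<lambda>a. restrict a S) ` T)"
      unfolding sum_distrib_left[symmetric] of_nat_mult using le by (intro mult_left_mono) auto
    finally show ?thesis .
  qed
  have jensen: "real (card T) powr t \<le> (\<Sum>S\<in>F. w S * (\<Prod>i\<in>S. 1 / d i a))" if a: "a \<in> T" for a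
  proof -
    define x where "x i = ln (1 / d i a)" for i
    \<comment> \<open>Swapping the sums gives every \<open>x i\<close> total weight
      \<open>t\<close>, so the exponent becomes \<open>t * ln (card T)\<close>.\<close>
    have "(\<Sum>S\<in>F. w S * sum x S) = (\<Sum>S\<in>F. \<Sum>i | i \<in> {..<p} \<and> i \<in> S. w S * x i)"
    proof (intro sum.cong refl)
      fix S assume "S \<in> F"
      then have "{i. i \<in> {..<p} \<and> i \<in> S} = S"
        using F by auto
      then show "w S * sum x S = (\<Sum>i | i \<in> {..<p} \<and> i \<in> S. w S * x i)"
        by (simp add: sum_distrib_left)
    qed
    also have "\<dots> = (\<Sum>i<p. \<Sum>S | S \<in> F \<and> i \<in> S. w S * x i)"
      using F by (intro sum.swap_restrict) auto
    also have "\<dots> = (\<Sum>i<p. t * x i)"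
      by (intro sum.cong refl) (simp add: cover flip: sum_distrib_right)
    also have "\<dots> = t * ln (\<Prod>i<p. 1 / d i a)"
      unfolding x_def using dpos[OF a, THEN less_imp_neq] dpos[OF a]
      by (subst ln_prod) (auto simp: sum_distrib_left)
    also have "(\<Prod>i<p. 1 / d i a) = card T"
      using prod_d[OF a] by (simp add: prod_dividef)
    finally have "real (card T) powr t = exp (\<Sum>S\<in>F. w S *\<^sub>R sum x S)"
      using cardT by (simp add: powr_def)
    also have "\<dots> \<le> (\<Sum>S\<in>F. w S * exp (sum x S))"
      using F w by (intro convex_on_sum[OF _ _ exp_convex]) auto
    also have "\<dots> = (\<Sum>S\<in>F. w S * (\<Prod>i\<in>S. 1 / d i a))"
    proof (intro sum.cong refl)
      fix S assume "S \<in> F"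
      then have "finite S"
        using F by (auto intro: finite_subset)
      then show "w S * exp (sum x S) = w S * (\<Prod>i\<in>S. 1 / d i a)"
        using dpos[OF a] by (simp add: exp_sum x_def)
    qed
    finally show ?thesis .
  qed
  have "card T * real (card T) powr t \<le> (\<Sum>a\<in>T. \<Sum>S\<in>F. w S * (\<Prod>i\<in>S. 1 / d i a))"
    using sum_mono[OF jensen, of T] by simp
  also have "\<dots> = (\<Sum>S\<in>F. w S * (\<Sum>a\<in>T. \<Prod>i\<in>S. 1 / d i a))"
    by (subst sum.swap) (simp add: sum_distrib_left)
  also have "\<dots> \<le> (\<Sum>S\<in>F. w S * (card T * card ((\<lambda>a. restrict a S) ` T)))"
    using step w by (intro sum_mono mult_left_mono) auto
  also have "\<dots> = card T * (\<Sum>S\<in>F. w S * card ((\<lambda>a. restrict a S) ` T))"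
    by (simp add: sum_distrib_left mult_ac)
  finally show ?thesis
    using cardT by simp
qed

section \<open>Restriction of lists, and projections of the cube\<close>

lemma nths_eq_nth_eq:
  assumes "length x = length y" "nths x S = nths y S" "i \<in> S" "i < length x"
  shows "x ! i = y ! i"
  using assms
proof (induction x y arbitrary: S i rule: list_induct2)
  case Nil
  then show ?case
    by simp
next
  case (Cons a x b y)
  have eq: "nths x {j. Suc j \<in> S} = nths y {j. Suc j \<in> S}"
    using Cons.prems by (auto simp: nths_Cons split: if_splits)
  show ?case
  proof (cases i)
    case 0
    then show ?thesis
      using Cons.prems by (simp add: nths_Cons)
  next
    case (Suc j)
    then show ?thesis
      using Cons.IH[OF eq, of j] Cons.prems by simp
  qed
qed

lemma nths_map2:
  assumes "length x = length y"
  shows "nths (map2 f x y) S = map2 f (nths x S) (nths y S)"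
  using assms by (induction x y arbitrary: S rule: list_induct2) (auto simp: nths_Cons)

text \<open>On bits this is addition modulo 2, as used for the upper bound. The general type lets
  the lower bound record where two words over \<open>{..<m}\<close> disagree.\<close>

definition ne_list :: "'a list \<Rightarrow> 'a list \<Rightarrow> bool list" where
  "ne_list = map2 (\<noteq>)"

lemma length_ne_list [simp]: "length (ne_list a b) = min (length a) (length b)"
  by (simp add: ne_list_def)

lemma nths_ne_list:
  "length a = length b \<Longrightarrow> nths (ne_list a b) S = ne_list (nths a S) (nths b S)"
  by (simp add: ne_list_def nths_map2)

lemma ne_list_ne_list_right: "length a = length b \<Longrightarrow> ne_list (ne_list a b) b = a"
  unfolding ne_list_def by (intro nth_equalityI) auto

lemma ne_list_ne_list_left: "length a = length b \<Longrightarrow> ne_list (ne_list a b) a = b"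
  unfolding ne_list_def by (intro nth_equalityI) auto

lemma ne_list_eq_zero_iff:
  assumes "length a = length b"
  shows "ne_list a b = replicate (length a) False \<longleftrightarrow> a = b"
  using assms by (auto simp: ne_list_def list_eq_iff_nth_eq)

lemma card_cube: "card (cube k) = 2 ^ k"
  using card_lists_length_eq[of "UNIV :: bool set" k] by (simp add: cube_def)

lemma finite_cube: "finite (cube k)"
  using finite_lists_length_eq[of "UNIV :: bool set" k] by (simp add: cube_def)

lemma length_nths_nsets:
  assumes "S \<in> nsets {..<p} q" "length x = p"
  shows "length (nths x S) = q"
proof -
  have "{i. i < p \<and> i \<in> S} = S" "card S = q"
    using assms by (auto simp: nsets_def)
  with assms show ?thesis
    by (simp add: length_nths)
qed

lemma nths_replicate_nsets:
  assumes "S \<in> nsets {..<p} q"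
  shows "nths (replicate p c) S = replicate q c"
  using length_nths_nsets[OF assms, of "replicate p c"]
  by (auto simp: set_nths intro!: replicate_eqI)

lemma OR_DP_subset_proj: "OR_DP p F \<subseteq> proj F ` cube p"
  by (auto simp: OR_DP_def)

lemma proj_not_in_OR_DP:
  "t \<in> proj F ` cube p \<Longrightarrow> t \<notin> OR_DP p F \<Longrightarrow> t = proj F (replicate p False)"
  by (auto simp: OR_DP_def)

lemma proj_inject:
  assumes "\<forall>i<p. \<exists>S\<in>F. i \<in> S" "length x = p" "length y = p" "proj F x = proj F y"
  shows "x = y"
proof (rule nth_equalityI)
  fix i assume i: "i < length x"
  with assms obtain S where S: "S \<in> F" "i \<in> S"
    by auto
  have "nths x S = nths y S"
    using fun_cong[OF assms(4), of S] S by (simp add: proj_def)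
  then show "x ! i = y ! i"
    using nths_eq_nth_eq assms i S by metis
qed (use assms in simp)

lemma proj_zero_notin_OR_DP:
  assumes "\<forall>i<p. \<exists>S\<in>F. i \<in> S"
  shows "proj F (replicate p False) \<notin> OR_DP p F"
  using proj_inject[OF assms, of "replicate p False"] by (auto simp: OR_DP_def cube_def)

text \<open>Otherwise \<open>i\<close> would be hit with probability 0, whereas \<open>q / p\<close>
  is positive. Covering makes \<open>proj F\<close> injective on \<open>cube p\<close>.\<close>

lemma regular_family_cover:
  assumes "regular_family p q F" "1 \<le> q" "i < p"
  shows "\<exists>S\<in>F. i \<in> S"
proof (rule ccontr)
  assume no: "\<not> ?thesis"
  obtain \<mu> where \<mu>: "set_pmf \<mu> \<subseteq> F" "measure_pmf.prob \<mu> {S. i \<in> S} = real q / real p"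
    using assms by (auto simp: regular_family_def)
  have "measure_pmf.prob \<mu> {S. i \<in> S} = 0"
    using no \<mu>(1) unfolding measure_pmf_zero_iff by auto
  with \<mu> assms show False
    by simp
qed

section \<open>Upper bound on non-redundant instances\<close>

text \<open>Translation by the assignment separating \<open>z\<close> carries the solutions of
  \<open>insert z Z\<close> to a disjoint copy inside \<open>Sat Z\<close>. Each clause thus costs a
  factor 2 out of \<open>2 ^ (q * card X)\<close>, and the zero assignment always survives.\<close>

lemma card_affine_instance_le:
  fixes F :: "nat set set" and X :: "'v set"
  assumes F: "F \<subseteq> nsets {..<p} q" and X: "finite X" and Y: "Y \<subseteq> (F \<rightarrow>\<^sub>E X)" "finite Y"
    and sep: "\<And>y. y \<in> Y \<Longrightarrow> \<exists>\<sigma> \<in> X \<rightarrow> cube q.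
      (\<forall>z\<in>Y - {y}. compose F \<sigma> z \<in> proj F ` cube p) \<and> compose F \<sigma> y \<notin> proj F ` cube p"
  shows "card Y \<le> q * card X"
proof -
  define Sat where
    "Sat Z = {\<sigma> \<in> X \<rightarrow>\<^sub>E cube q. \<forall>z\<in>Z. compose F \<sigma> z \<in> proj F ` cube p}" for Z
  define add where "add \<sigma> \<tau> = (\<lambda>v\<in>X. ne_list (\<sigma> v) (\<tau> v))" for \<sigma> \<tau> :: "'v \<Rightarrow> bool list"
  have finSat: "finite (Sat Z)" for Z
    by (rule finite_subset[OF _ finite_PiE[OF X finite_cube]]) (auto simp: Sat_def)
  \<comment> \<open>\<open>nths\<close> commutes with \<open>ne_list\<close>, so the projections of
    the cube are closed under coordinatewise addition.\<close>
  have add_proj: "compose F (add \<sigma> \<tau>) z \<in> proj F ` cube p"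
    if sat: "z \<in> Y" "compose F \<sigma> z \<in> proj F ` cube p" "compose F \<tau> z \<in> proj F ` cube p" for \<sigma> \<tau> z
  proof -
    obtain x x' where x: "compose F \<sigma> z = proj F x" "compose F \<tau> z = proj F x'"
        "length x = p" "length x' = p"
      using sat by (auto simp: cube_def)
    have "compose F (add \<sigma> \<tau>) z = proj F (ne_list x x')"
    proof
      fix S
      show "compose F (add \<sigma> \<tau>) z S = proj F (ne_list x x') S"
      proof (cases "S \<in> F")
        case True
        then have "z S \<in> X"
          using sat Y by auto
        moreover have "\<sigma> (z S) = nths x S" "\<tau> (z S) = nths x' S"
          using True fun_cong[OF x(1), of S] fun_cong[OF x(2), of S]
          by (auto simp: compose_def proj_def)
        ultimately show ?thesis
          using True x by (simp add: compose_def proj_def add_def nths_ne_list)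
      qed (simp add: compose_def proj_def)
    qed
    then show ?thesis
      using x by (auto simp: cube_def)
  qed
  have add_in: "add \<sigma> \<tau> \<in> X \<rightarrow>\<^sub>E cube q" if "\<sigma> \<in> X \<rightarrow>\<^sub>E cube q" "\<tau> \<in> X \<rightarrow>\<^sub>E cube q" for \<sigma> \<tau>
    using that by (fastforce simp: add_def cube_def PiE_iff)
  \<comment> \<open>Adding the same assignment twice cancels. The second form gives injectivity of
    the translation, the first disjointness.\<close>
  have add_add: "add (add \<sigma> \<tau>) \<tau> = \<sigma>" "add (add \<sigma> \<tau>) \<sigma> = \<tau>"
    if "\<sigma> \<in> X \<rightarrow>\<^sub>E cube q" "\<tau> \<in> X \<rightarrow>\<^sub>E cube q" for \<sigma> \<tau>
  proof -
    have "length (\<sigma> v) = length (\<tau> v)" if "v \<in> X" for v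
      using that \<open>\<sigma> \<in> _\<close> \<open>\<tau> \<in> _\<close> by (auto simp: cube_def PiE_iff)
    then show "add (add \<sigma> \<tau>) \<tau> = \<sigma>" "add (add \<sigma> \<tau>) \<sigma> = \<tau>"
      using that by (auto simp: add_def ne_list_ne_list_right ne_list_ne_list_left PiE_iff intro!: extensionalityI[where A = X])
  qed
  have "2 ^ card Z * card (Sat Z) \<le> 2 ^ (q * card X)" if "finite Z" "Z \<subseteq> Y" for Z
    using that
  proof (induction Z)
    case empty
    have "card (Sat {}) = 2 ^ (q * card X)"
      using X by (simp add: Sat_def card_PiE card_cube flip: power_mult)
    then show ?case
      by simp
  next
    case (insert z Z)
    obtain \<sigma>0 where \<sigma>0: "\<sigma>0 \<in> X \<rightarrow> cube q" "\<forall>y\<in>Y - {z}. compose F \<sigma>0 y \<in> proj F ` cube p"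
        "compose F \<sigma>0 z \<notin> proj F ` cube p"
      using sep insert.prems by (meson insert_subset)
    \<comment> \<open>\<open>Sat\<close> counts extensional assignments; clauses take values in
      \<open>X\<close>, so restricting does not affect them.\<close>
    define \<sigma> where "\<sigma> = restrict \<sigma>0 X"
    have compose_\<sigma>: "compose F \<sigma> y = compose F \<sigma>0 y" if "y \<in> Y" for y
      using that Y by (auto simp: compose_def \<sigma>_def fun_eq_iff PiE_iff subset_iff)
    have "compose F \<sigma> y \<in> proj F ` cube p" if "y \<in> Z" for y
    proof -
      have "y \<in> Y - {z}"
        using that insert by auto
      then show ?thesis
        using \<sigma>0(2) compose_\<sigma>[of y] by simp
    qed
    then have \<sigma>: "\<sigma> \<in> X \<rightarrow>\<^sub>E cube q" "\<sigma> \<in> Sat Z" "compose F \<sigma> z \<notin> proj F ` cube p"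
      using \<sigma>0 insert.prems compose_\<sigma>[of z] by (auto simp: Sat_def \<sigma>_def)
    let ?I = "Sat (insert z Z)"
    have I: "\<tau> \<in> X \<rightarrow>\<^sub>E cube q" if "\<tau> \<in> ?I" for \<tau>
      using that by (simp add: Sat_def)
    have inj: "inj_on (add \<sigma>) ?I"
      using add_add(2)[OF \<sigma>(1) I] by (intro inj_on_inverseI[where g = "\<lambda>\<tau>. add \<tau> \<sigma>"])
    have disj: "add \<sigma> \<tau> \<notin> ?I" if \<tau>: "\<tau> \<in> ?I" for \<tau>
    proof
      assume "add \<sigma> \<tau> \<in> ?I"
      then have "compose F (add (add \<sigma> \<tau>) \<tau>) z \<in> proj F ` cube p"
        using \<tau> insert.prems by (intro add_proj[of z "add \<sigma> \<tau>" \<tau>]) (simp_all add: Sat_def)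
      then show False
        using add_add(1)[OF \<sigma>(1) I[OF \<tau>]] \<sigma>(3) by simp
    qed
    have sub: "add \<sigma> \<tau> \<in> Sat Z" if \<tau>: "\<tau> \<in> ?I" for \<tau>
      using \<tau> \<sigma> insert.prems add_in[OF \<sigma>(1) I[OF \<tau>]] by (auto simp: Sat_def intro!: add_proj)
    have "2 * card ?I = card (?I \<union> add \<sigma> ` ?I)"
      using finSat disj by (subst card_Un_disjoint) (auto simp: card_image[OF inj])
    also have "\<dots> \<le> card (Sat Z)"
      using sub finSat by (intro card_mono) (auto simp: Sat_def)
    finally have "2 ^ card (insert z Z) * card ?I \<le> 2 ^ card Z * card (Sat Z)"
      using insert.hyps by simp
    also have "\<dots> \<le> 2 ^ (q * card X)"
      using insert by simp
    finally show ?case .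
  qed
  from this[OF Y(2) order_refl] have le: "2 ^ card Y * card (Sat Y) \<le> 2 ^ (q * card X)" .
  define \<zeta> where "\<zeta> = (\<lambda>v\<in>X. replicate q False)"
  have "compose F \<zeta> z = proj F (replicate p False)" if "z \<in> Y" for z
    using that Y F
    by (auto simp: compose_def proj_def \<zeta>_def fun_eq_iff PiE_iff subset_iff nths_replicate_nsets)
  then have "\<zeta> \<in> Sat Y"
    by (auto simp: Sat_def \<zeta>_def cube_def)
  then have "card (Sat Y) \<ge> 1"
    using finSat by (simp add: Suc_le_eq card_gt_0_iff) blast
  then have "(2::nat) ^ card Y * 1 \<le> 2 ^ card Y * card (Sat Y)"
    by (intro mult_left_mono) auto
  with le have "(2::nat) ^ card Y \<le> 2 ^ (q * card X)"
    by linarith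
  then show ?thesis
    by simp
qed

text \<open>Regularity acts as a fractional cover: with weights \<open>pmf \<mu>\<close> and
  \<open>t = q / p\<close>, Shearer's inequality bounds \<open>card Y powr (q / p)\<close> by an
  average of projection sizes, each at most \<open>card X\<close>.\<close>

lemma card_OR_instance_le:
  fixes F :: "nat set set" and X :: "'v set"
  assumes q: "1 \<le> q" "q \<le> p" and F: "F \<subseteq> nsets {..<p} q" and reg: "regular_family p q F"
    and X: "finite X" and Y: "Y \<subseteq> (F \<rightarrow>\<^sub>E X)" "finite Y"
    and sep: "\<And>y. y \<in> Y \<Longrightarrow> \<exists>\<sigma>.
      (\<forall>z\<in>Y - {y}. compose F \<sigma> z \<in> OR_DP p F) \<and> compose F \<sigma> y = proj F (replicate p False)"
  shows "real (card Y) \<le> real (card X) powr (real p / real q)"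
proof (cases "Y = {}")
  case False
  obtain s where s: "\<And>w y. w \<in> Y \<Longrightarrow> y \<in> Y \<Longrightarrow> y \<noteq> w \<Longrightarrow> compose F (s w) y \<in> OR_DP p F"
      "\<And>w. w \<in> Y \<Longrightarrow> compose F (s w) w = proj F (replicate p False)"
    using sep by (metis Diff_iff singletonD)
  \<comment> \<open>Row \<open>w\<close> comes from the assignment separating \<open>w\<close>.
    Membership in \<open>OR_DP\<close> supplies a nonzero preimage off the diagonal; zero is chosen
    on it.\<close>
  have "\<forall>w y. \<exists>x. w \<in> Y \<longrightarrow> y \<in> Y \<longrightarrow>
      length x = p \<and> compose F (s w) y = proj F x \<and> (x = replicate p False \<longleftrightarrow> y = w)"
  proof (intro allI)
    fix w y
    show "\<exists>x. w \<in> Y \<longrightarrow> y \<in> Y \<longrightarrow>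
        length x = p \<and> compose F (s w) y = proj F x \<and> (x = replicate p False \<longleftrightarrow> y = w)"
      using s(1)[of w y] s(2)[of w] by (cases "y = w") (auto simp: OR_DP_def cube_def)
  qed
  then obtain x where x: "\<And>w y. w \<in> Y \<Longrightarrow> y \<in> Y \<Longrightarrow> length (x w y) = p"
      "\<And>w y. w \<in> Y \<Longrightarrow> y \<in> Y \<Longrightarrow> compose F (s w) y = proj F (x w y)"
      "\<And>w y. w \<in> Y \<Longrightarrow> y \<in> Y \<Longrightarrow> x w y = replicate p False \<longleftrightarrow> y = w"
    by metis
  define A where "A y = (\<lambda>i\<in>{..<p}. {w \<in> Y. x w y ! i})" for y
  have injA: "inj_on A Y"
  proof (rule inj_onI)
    fix y z assume yz: "y \<in> Y" "z \<in> Y" "A y = A z"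
    \<comment> \<open>Row \<open>y\<close> suffices, since \<open>x y z\<close> is zero exactly for
      \<open>z = y\<close>.\<close>
    have "x y z ! i = x y y ! i" if "i < p" for i
      using fun_cong[OF yz(3), of i] that yz by (auto simp: A_def)
    then have "x y z = x y y"
      using x(1) yz by (intro nth_equalityI) auto
    then show "y = z"
      using x(3)[of y y] x(3)[of y z] yz by simp
  qed
  have A_cong: "restrict (A y) S = restrict (A z) S"
    if "S \<in> F" "y \<in> Y" "z \<in> Y" "y S = z S" for S y z
  proof
    fix i
    have "x w y ! i = x w z ! i" if w: "w \<in> Y" and i: "i \<in> S" "i < p" for w
    proof -
      have "nths (x w y) S = s w (y S)" "nths (x w z) S = s w (z S)"
        using x(2)[OF w \<open>y \<in> Y\<close>, THEN fun_cong, of S] x(2)[OF w \<open>z \<in> Y\<close>, THEN fun_cong, of S] \<open>S \<in> F\<close>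
        by (auto simp: compose_def proj_def)
      then show ?thesis
        using \<open>y S = z S\<close> x(1) w i \<open>y \<in> Y\<close> \<open>z \<in> Y\<close>
        by (intro nths_eq_nth_eq[of _ _ S]) auto
    qed
    then show "restrict (A y) S i = restrict (A z) S i"
      by (auto simp: A_def restrict_def)
  qed
  have card_restrict: "card ((\<lambda>a. restrict a S) ` A ` Y) \<le> card X" if S: "S \<in> F" for S
  proof -
    \<comment> \<open>One clause with value \<open>v\<close> at \<open>S\<close> is chosen. Where no
      clause takes the value \<open>v\<close>, \<open>g v\<close> is arbitrary, which is harmless
      for an inclusion in the image of \<open>X\<close>.\<close>
    define g where "g v = restrict (A (inv_into Y (\<lambda>y. y S) v)) S" for v
    have "restrict (A y) S = g (y S)" if "y \<in> Y" for y
      unfolding g_def using that S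
      by (intro A_cong) (auto intro: inv_into_into f_inv_into_f[where f = "\<lambda>y. y S", symmetric])
    moreover have "y S \<in> X" if "y \<in> Y" for y
      using that Y S by auto
    ultimately have "(\<lambda>a. restrict a S) ` A ` Y \<subseteq> g ` X"
      by auto
    then show ?thesis
      using X by (meson card_image_le card_mono finite_imageI order_trans)
  qed
  obtain \<mu> where \<mu>: "set_pmf \<mu> \<subseteq> F"
      "\<And>i. i < p \<Longrightarrow> measure_pmf.prob \<mu> {S. i \<in> S} = real q / real p"
    using reg by (auto simp: regular_family_def)
  have FPow: "F \<subseteq> Pow {..<p}"
    using F by (auto simp: nsets_def)
  then have finF: "finite F"
    by (rule finite_subset) simp
  have "(\<Sum>S | S \<in> F \<and> i \<in> S. pmf \<mu> S) = real q / real p" if "i < p" for i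
  proof -
    have "measure_pmf.prob \<mu> {S. i \<in> S} = measure_pmf.prob \<mu> {S. S \<in> F \<and> i \<in> S}"
      using \<mu>(1) by (intro measure_eq_AE) (auto simp: AE_measure_pmf_iff)
    then show ?thesis
      using \<mu>(2)[OF that] finF by (simp add: measure_measure_pmf_finite)
  qed
  then have "real (card (A ` Y)) powr (real q / real p)
      \<le> (\<Sum>S\<in>F. pmf \<mu> S * real (card ((\<lambda>a. restrict a S) ` A ` Y)))"
    using False Y finF FPow sum_pmf_eq_1[OF finF \<mu>(1)]
    by (intro shearer_inequality[where p = p]) (auto simp: A_def)
  also have "\<dots> \<le> (\<Sum>S\<in>F. pmf \<mu> S * real (card X))"
    using card_restrict by (intro sum_mono mult_left_mono) auto
  also have "\<dots> = real (card X)"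
    using sum_pmf_eq_1[OF finF \<mu>(1)] by (simp flip: sum_distrib_right)
  finally have "real (card Y) powr (real q / real p) \<le> real (card X)"
    by (simp add: card_image[OF injA])
  then have "(real (card Y) powr (real q / real p)) powr (real p / real q)
      \<le> real (card X) powr (real p / real q)"
    by (intro powr_mono2) auto
  then show ?thesis
    using q by (simp add: powr_powr)
qed simp

text \<open>The two kinds of clauses contribute \<open>q * card X\<close> and
  \<open>card X powr (p / q)\<close>. As \<open>p / q \<ge> 1\<close> and
  \<open>card X \<ge> 1\<close>, the linear term is absorbed into the constant
  \<open>q + 1\<close>.\<close>

lemma card_non_redundant_le:
  fixes F :: "nat set set" and X :: "'v set"
  assumes q: "1 \<le> q" "q \<le> p" and F: "F \<subseteq> nsets {..<p} q" and reg: "regular_family p q F"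
    and nr: "non_redundant (cube q) F (OR_DP p F) X Y" and n: "1 \<le> card X"
  shows "real (card Y) \<le> (real q + 1) * real (card X) powr (real p / real q)"
proof -
  have "F \<subseteq> Pow {..<p}"
    using F by (auto simp: nsets_def)
  then have "finite F"
    by (rule finite_subset) simp
  have X: "finite X" and Y: "Y \<subseteq> (F \<rightarrow>\<^sub>E X)"
    using nr by (auto simp: non_redundant_def)
  have finY: "finite Y"
    using Y X \<open>finite F\<close> by (meson finite_PiE finite_subset)
  obtain s where s: "\<And>y. y \<in> Y \<Longrightarrow> s y \<in> X \<rightarrow> cube q"
      "\<And>y z. y \<in> Y \<Longrightarrow> z \<in> Y - {y} \<Longrightarrow> compose F (s y) z \<in> OR_DP p F"
      "\<And>y. y \<in> Y \<Longrightarrow> compose F (s y) y \<notin> OR_DP p F"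
    using nr unfolding non_redundant_def by metis
  define Z where "Z = {y \<in> Y. compose F (s y) y \<in> proj F ` cube p}"
  have "card (Y - Z) \<le> q * card X"
  proof (rule card_affine_instance_le[OF F X])
    fix y assume y: "y \<in> Y - Z"
    then show "\<exists>\<sigma>\<in>X \<rightarrow> cube q. (\<forall>z\<in>Y - Z - {y}. compose F \<sigma> z \<in> proj F ` cube p) \<and>
        compose F \<sigma> y \<notin> proj F ` cube p"
      using s(1)[of y] s(2)[of y] OR_DP_subset_proj[of p F]
      by (intro bexI[of _ "s y"]) (auto simp: Z_def)
  qed (use Y finY in auto)
  then have "real (card (Y - Z)) \<le> real q * real (card X) powr 1"
    using n by (metis of_nat_le_iff of_nat_mult of_nat_0_le_iff powr_one)
  also have "\<dots> \<le> real q * real (card X) powr (real p / real q)"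
    using n q by (intro mult_left_mono powr_mono) auto
  finally have 1: "real (card (Y - Z)) \<le> real q * real (card X) powr (real p / real q)" .
  have 2: "real (card Z) \<le> real (card X) powr (real p / real q)"
  proof (rule card_OR_instance_le[OF q F reg X])
    fix y assume y: "y \<in> Z"
    then have "compose F (s y) y = proj F (replicate p False)"
      using s(3)[of y] by (intro proj_not_in_OR_DP) (auto simp: Z_def)
    then show "\<exists>\<sigma>. (\<forall>z\<in>Z - {y}. compose F \<sigma> z \<in> OR_DP p F) \<and>
        compose F \<sigma> y = proj F (replicate p False)"
      using y s(2)[of y] by (auto simp: Z_def)
  qed (use Y finY in \<open>auto simp: Z_def\<close>)
  have "card Y = card (Y - Z) + card Z"
    using finY card_Diff_subset[of Z Y] card_mono[of Y Z] finite_subset[of Z Y]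
    by (auto simp: Z_def)
  with 1 2 show ?thesis
    by (simp add: algebra_simps)
qed

section \<open>Bounds on the maximum, and instances for the lower bound\<close>

lemma NRD_le:
  assumes "finite I"
    and "\<And>X Y. card X = n \<Longrightarrow> non_redundant D I R (X :: nat set) Y \<Longrightarrow> real (card Y) \<le> C"
  shows "real (NRD D I R n) \<le> C"
proof -
  have "NRD D I R n \<in> {card Y |(X :: nat set) Y. card X = n \<and> non_redundant D I R X Y}"
    unfolding NRD_def using NRD_Max_well_defined[OF assms(1)] by (rule Max_in)
  then show ?thesis
    using assms(2) by auto
qed

lemma NRD_ge:
  assumes "finite I" "card (X :: nat set) = n" "non_redundant D I R X Y"
  shows "card Y \<le> NRD D I R n"
  unfolding NRD_def using NRD_Max_well_defined(1)[OF assms(1)] by (rule Max_ge) (use assms in auto)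

text \<open>Serves small \<open>n\<close>: a single clause is separated by the all-zero
  assignment.\<close>

lemma NRD_OR_DP_ge_1:
  assumes F: "F \<subseteq> nsets {..<p} q" "finite F" and cover: "\<forall>i<p. \<exists>S\<in>F. i \<in> S" and n: "1 \<le> n"
  shows "1 \<le> NRD (cube q) F (OR_DP p F) n"
proof -
  let ?y = "\<lambda>S\<in>F. 0 :: nat"
  have "compose F (\<lambda>_. replicate q False) ?y = proj F (replicate p False)"
    using F by (auto simp: compose_def proj_def fun_eq_iff nths_replicate_nsets)
  then have "compose F (\<lambda>_. replicate q False) ?y \<notin> OR_DP p F"
    using proj_zero_notin_OR_DP[OF cover] by simp
  then have "non_redundant (cube q) F (OR_DP p F) {..<n} {?y}"
    using n unfolding non_redundant_def
    by (auto intro!: bexI[of _ "\<lambda>_. replicate q False"] simp: cube_def)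
  from NRD_ge[OF F(2) _ this, of n] show ?thesis
    by simp
qed

text \<open>The \<open>card F * m ^ q\<close> variables \<open>(S, b)\<close> must fit into
  \<open>n\<close>. The \<open>m ^ p\<close> words give distinct clauses because \<open>F\<close>
  covers all coordinates.\<close>

lemma NRD_OR_DP_ge:
  assumes F: "F \<subseteq> nsets {..<p} q" "finite F" and cover: "\<forall>i<p. \<exists>S\<in>F. i \<in> S"
    and n: "card F * m ^ q \<le> n"
  shows "m ^ p \<le> NRD (cube q) F (OR_DP p F) n"
proof -
  define V where "V = F \<times> {b. set b \<subseteq> {..<m} \<and> length b = q}"
  have V: "finite V" "card V = card F * m ^ q"
    unfolding V_def using F finite_lists_length_eq[of "{..<m}" q]
    by (auto simp: card_cartesian_product card_lists_length_eq)
  obtain f where f: "f ` V \<subseteq> {..<n}" "inj_on f V"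
    using card_le_inj[of V "{..<n}"] V n by auto
  define P where "P = {a. set a \<subseteq> {..<m} \<and> length a = p}"
  define y where "y a = (\<lambda>S\<in>F. f (S, nths a S))" for a
  have inV: "(S, nths a S) \<in> V" if "S \<in> F" "a \<in> P" for S a
    using that F(1) length_nths_nsets[of S p q a] set_nths_subset[of a S]
    by (auto simp: V_def P_def)
  have inj_y: "inj_on y P"
  proof (rule inj_onI)
    fix a a' assume a: "a \<in> P" "a' \<in> P" "y a = y a'"
    have "nths a S = nths a' S" if S: "S \<in> F" for S
      using fun_cong[OF a(3), of S] S inj_onD[OF f(2) _ inV[OF S a(1)] inV[OF S a(2)]]
      by (simp add: y_def)
    then have proj_list: "\<forall>S\<in>F. nths a S = nths a' S"
      by blast
    show "a = a'"
    proof (rule nth_equalityI)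
      show "length a = length a'"
        using a by (simp add: P_def)
      fix i assume i: "i < length a"
      then obtain S where "S \<in> F" "i \<in> S"
        using cover a by (auto simp: P_def)
      then show "a ! i = a' ! i"
        using proj_list i a nths_eq_nth_eq[of a a' S i] by (simp add: P_def)
    qed
  qed
  \<comment> \<open>Numbers outside the image of \<open>f\<close> occur in no clause; the default
    only keeps the value in \<open>cube q\<close>.\<close>
  define \<sigma> where "\<sigma> a v = (if v \<in> f ` V
      then ne_list (snd (inv_into V f v)) (nths a (fst (inv_into V f v)))
      else replicate q False)" for a v
  have \<sigma>_f: "\<sigma> a (f (S, b)) = ne_list b (nths a S)" if "(S, b) \<in> V" for a S b
    using that f(2) by (auto simp: \<sigma>_def inv_into_f_f)
  have \<sigma>_cube: "\<sigma> a v \<in> cube q" if a: "a \<in> P" for a v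
  proof (cases "v \<in> f ` V")
    case True
    then obtain S b where Sb: "(S, b) \<in> V" "v = f (S, b)"
      by auto
    then have "length b = q" "length (nths a S) = q"
      using a F(1) length_nths_nsets[of S p q a] by (auto simp: V_def P_def)
    then show ?thesis
      using Sb \<sigma>_f by (simp add: cube_def)
  qed (simp add: \<sigma>_def cube_def)
  \<comment> \<open>The clause of \<open>a'\<close> becomes the projection of a single disagreement
    pattern, which is zero iff \<open>a' = a\<close>.\<close>
  have \<sigma>_y: "compose F (\<sigma> a) (y a') = proj F (ne_list a' a)" if "a \<in> P" "a' \<in> P" for a a'
    using that inV \<sigma>_f by (auto simp: compose_def proj_def y_def fun_eq_iff nths_ne_list P_def)
  have "non_redundant (cube q) F (OR_DP p F) {..<n} (y ` P)"
    unfolding non_redundant_def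
  proof (intro conjI ballI)
    show "y ` P \<subseteq> F \<rightarrow>\<^sub>E {..<n}"
      using inV f(1) by (fastforce simp: y_def)
  next
    fix u assume "u \<in> y ` P"
    then obtain a where a: "a \<in> P" "u = y a"
      by auto
    have "compose F (\<sigma> a) u \<notin> OR_DP p F"
      using a ne_list_eq_zero_iff[of a a] \<sigma>_y[of a a] proj_zero_notin_OR_DP[OF cover]
      by (simp add: P_def)
    moreover have "compose F (\<sigma> a) z \<in> OR_DP p F" if z: "z \<in> y ` P - {u}" for z
    proof -
      obtain a' where a': "a' \<in> P" "z = y a'" "a' \<noteq> a"
        using z a by auto
      then have "ne_list a' a \<in> cube p - {replicate p False}"
        using a ne_list_eq_zero_iff[of a' a] by (auto simp: P_def cube_def)
      then show ?thesis
        using \<sigma>_y[OF a(1) a'(1)] a' by (simp add: OR_DP_def)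
    qed
    ultimately show "\<exists>\<sigma>\<in>{..<n} \<rightarrow> cube q. (\<forall>z\<in>y ` P - {u}. compose F \<sigma> z \<in> OR_DP p F) \<and>
        compose F \<sigma> u \<notin> OR_DP p F"
      using \<sigma>_cube[OF a(1)] by (intro bexI[of _ "\<sigma> a"]) auto
  qed simp
  from NRD_ge[OF F(2) _ this, of n] have "card P \<le> NRD (cube q) F (OR_DP p F) n"
    by (simp add: card_image[OF inj_y])
  then show ?thesis
    by (simp add: P_def card_lists_length_eq)
qed

section \<open>Choice of constants and the asymptotic bound\<close>

theorem theorem3p13:
  fixes p q :: nat
  assumes "1 \<le> q" and "q \<le> p"
  shows "\<exists>c>0. \<exists>C>0. \<forall>F. F \<subseteq> nsets {..<p} q \<longrightarrow> regular_family p q F \<longrightarrow>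
    (\<forall>n\<ge>1. c * real n powr (real p / real q) \<le> real (NRD (cube q) F (OR_DP p F) n) \<and>
            real (NRD (cube q) F (OR_DP p F) n) \<le> C * real n powr (real p / real q))"
proof -
  define r where "r = real p / real q"
  \<comment> \<open>One \<open>2 ^ p\<close> bounds \<open>card F\<close>, so \<open>n\<close> is
    divided by it before taking the power \<open>r\<close>. The other pays for rounding:
    \<open>m \<ge> t / 2\<close> is raised to the power \<open>p\<close>.\<close>
  define c :: real where "c = 1 / (2 ^ p * (2 ^ p) powr r)"
  have c: "c * real n powr r \<le> real (NRD (cube q) F (OR_DP p F) n)"
    if F: "F \<subseteq> nsets {..<p} q" and reg: "regular_family p q F" and n: "1 \<le> n" for F n
  proof -
    have FPow: "F \<subseteq> Pow {..<p}"
      using F by (auto simp: nsets_def)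
    then have finF: "finite F"
      by (rule finite_subset) simp
    have cardF: "card F \<le> 2 ^ p"
      using card_mono[OF _ FPow] by (simp add: card_Pow)
    have cover: "\<forall>i<p. \<exists>S\<in>F. i \<in> S"
      using regular_family_cover[OF reg] assms by blast
    have c_eq: "c * real n powr r = (real n / 2 ^ p) powr r / 2 ^ p"
      by (simp add: c_def powr_divide)
    show ?thesis
    \<comment> \<open>Below \<open>2 ^ p\<close> the left side is at most 1 and one clause suffices.
      Otherwise \<open>t \<ge> 1\<close>, so rounding \<open>t\<close> down loses at most a factor
      2.\<close>
    proof (cases "n < 2 ^ p")
      case True
      have "(real n / 2 ^ p) powr r \<le> 1 powr r"
        using True by (intro powr_mono2) (auto simp: r_def less_imp_le)
      then have "c * real n powr r \<le> 1"
        unfolding c_eq by (simp add: divide_le_eq order_trans[of _ 1])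
      also have "\<dots> \<le> real (NRD (cube q) F (OR_DP p F) n)"
        using NRD_OR_DP_ge_1[OF F finF cover n] by simp
      finally show ?thesis .
    next
      case False
      \<comment> \<open>\<open>t\<close> solves \<open>2 ^ p * t ^ q = n\<close>, so the instance
        with \<open>m = nat \<lfloor>t\<rfloor>\<close> fits into \<open>n\<close>
        variables.\<close>
      define t where "t = (real n / 2 ^ p) powr (1 / real q)"
      have ge1: "real n / 2 ^ p \<ge> 1"
        using False by (simp add: not_less)
      then have t: "t \<ge> 1"
        unfolding t_def by (intro ge_one_powr_ge_zero) auto
      have t_pow: "t ^ k = (real n / 2 ^ p) powr (real k / real q)" for k
      proof -
        have "t ^ k = t powr real k"
          using t by (simp add: powr_realpow)
        then show ?thesis
          unfolding t_def powr_powr by simp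
      qed
      define m where "m = nat \<lfloor>t\<rfloor>"
      have q0: "q \<noteq> 0"
        using assms by auto
      have "\<lfloor>t\<rfloor> \<ge> 1"
        using t by simp
      then have m: "real m \<le> t" "t / 2 \<le> real m"
        unfolding m_def by linarith+
      have "real (m ^ q) \<le> t ^ q"
        using m(1) by (simp add: power_mono)
      also have "t ^ q = real n / 2 ^ p"
        using ge1 q0 by (simp add: t_pow)
      finally have "real (2 ^ p * m ^ q) \<le> real n"
        by (simp add: field_simps)
      then have "2 ^ p * m ^ q \<le> n"
        by (simp only: of_nat_le_iff)
      then have "card F * m ^ q \<le> n"
        using cardF by (meson mult_right_mono order_trans zero_le)
      then have "m ^ p \<le> NRD (cube q) F (OR_DP p F) n"
        by (rule NRD_OR_DP_ge[OF F finF cover])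
      moreover have "(t / 2) ^ p \<le> real m ^ p"
        using m t by (intro power_mono) auto
      moreover have "t ^ p = (real n / 2 ^ p) powr r"
        by (simp add: t_pow r_def)
      ultimately show ?thesis
        unfolding c_eq by (simp add: power_divide) (metis of_nat_le_iff of_nat_power order_trans)
    qed
  qed
  have C: "real (NRD (cube q) F (OR_DP p F) n) \<le> (real q + 1) * real n powr r"
    if F: "F \<subseteq> nsets {..<p} q" and reg: "regular_family p q F" and n: "1 \<le> n" for F n
  proof -
    have "F \<subseteq> Pow {..<p}"
      using F by (auto simp: nsets_def)
    then have "finite F"
      by (rule finite_subset) simp
    then show ?thesis
      using card_non_redundant_le[OF assms F reg] n by (intro NRD_le) (auto simp: r_def)
  qed
  have "c > 0" "real q + 1 > 0"
    by (auto simp: c_def)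
  then show ?thesis
    using c C unfolding r_def by blast
qed

end
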